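(* Let $q=p^k$ for some prime $p\ne 3$ and some integer $k>0$. Let $Q,R,S$ be integers each of the form $p^i$ for some integer $i\ge 0$ (the exponents may differ). Let $r>0$ be an integer such that $r\equiv Q+R+S\pmod{q+1}$ and $\gcd(r,q-1)=1$. For $j\in\{1,2,3,4\}$ let $f_j(X):=X^rB_j(X^{q-1})$, where $$B_1(X):=X^{Q+R+S}-X^Q-X^R-X^S+1,$$ $$B_2(X):=X^{Q+R+S}-X^Q-X^R-X^S-1,$$ $$B_3(X):=X^{Q+R}-X^{Q+S}-X^{R+S}+X^S-1,$$ $$B_4(X):=X^{Q+R}-X^{Q+S}-X^{R+S}-X^S-1.$$ Then the following hold. (1) For each $j\in\{1,2\}$, $f_j(X)$ permutes $\mathbb{F}_{q^2}$ if one of the following holds: (a) $q\equiv 1\pmod 3$ and $(Q,R,S)\equiv\pm(1,1,1)\pmod 3$ and $\gcd(Q+R+S,q+1)=1$; (b) $q\equiv -1\pmod 3$ and $(Q,R,S)\equiv\pm(1,1,1)\pmod 3$ and $\gcd(Q+R+S,q-1)=1$; (c) $q\equiv 1\pmod 3$ and $(Q,R,S)\equiv\pm(1,1,-1)\pmod 3$ and $\gcd(Q+R-S,q+1)=1$. (2) For each $j\in\{3,4\}$, $f_j(X)$ permutes $\mathbb{F}_{q^2}$ if one of the following holds: (a) $q\equiv 1\pmod 3$ and $(Q,R,S)\equiv\pm(1,1,-1)\pmod 3$ and $\gcd(Q+R+S,q+1)=1$; (b) $q\equiv -1\pmod 3$ and $(Q,R,S)\equiv\pm(1,1,-1)\pmod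 3$ and $\gcd(Q+R+S,q-1)=1$; (c) $q\equiv 1\pmod 3$ and $(Q,R,S)\equiv\pm(1,1,1)\pmod 3$ and $\gcd(Q+R-S,q+1)=1$; (d) $q\equiv 1\pmod 3$ and $(Q,R,S)\equiv\pm(1,-1,1)\pmod 3$ and $\gcd(Q-R-S,q+1)=1$.
   Context: A polynomial $f(X)\in\mathbb{F}_{q^2}[X]$ permutes $\mathbb{F}_{q^2}$ if the map $\alpha\mapsto f(\alpha)$ is a bijection of $\mathbb{F}_{q^2}$. For integers $\epsilon_1,\epsilon_2,\epsilon_3$, the notation $(Q,R,S)\equiv\pm(\epsilon_1,\epsilon_2,\epsilon_3)\pmod 3$ means that there is a single sign $s\in\{1,-1\}$ with $Q\equiv s\epsilon_1$, $R\equiv s\epsilon_2$, $S\equiv s\epsilon_3\pmod 3$. *)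

theory Defs
  imports
    "HOL-Computational_Algebra.Polynomial"
    "HOL-Computational_Algebra.Primes"
    "HOL-Number_Theory.Cong"
begin

definition permutation_poly :: "'a::comm_semiring_0 poly \<Rightarrow> bool" where
  "permutation_poly f \<longleftrightarrow> bij (poly f)"

(* A single sign s serves all three congruences. *)
definition pm_cong3 :: "int \<times> int \<times> int \<Rightarrow> int \<times> int \<times> int \<Rightarrow> bool" where
  "pm_cong3 = (\<lambda>(Q, R, S) (e1, e2, e3).
     \<exists>s\<in>{1, -1}. [Q = s * e1] (mod 3) \<and> [R = s * e2] (mod 3) \<and> [S = s * e3] (mod 3))"

definition B1 :: "nat \<Rightarrow> nat \<Rightarrow> nat \<Rightarrow> 'a::comm_ring_1 poly" where
  "B1 Q R S = monom 1 (Q + R + S) - monom 1 Q - monom 1 R - monom 1 S + 1"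

definition B2 :: "nat \<Rightarrow> nat \<Rightarrow> nat \<Rightarrow> 'a::comm_ring_1 poly" where
  "B2 Q R S = monom 1 (Q + R + S) - monom 1 Q - monom 1 R - monom 1 S - 1"

definition B3 :: "nat \<Rightarrow> nat \<Rightarrow> nat \<Rightarrow> 'a::comm_ring_1 poly" where
  "B3 Q R S = monom 1 (Q + R) - monom 1 (Q + S) - monom 1 (R + S) + monom 1 S - 1"

definition B4 :: "nat \<Rightarrow> nat \<Rightarrow> nat \<Rightarrow> 'a::comm_ring_1 poly" where
  "B4 Q R S = monom 1 (Q + R) - monom 1 (Q + S) - monom 1 (R + S) - monom 1 S - 1"

definition f_poly :: "nat \<Rightarrow> nat \<Rightarrow> 'a::comm_ring_1 poly \<Rightarrow> 'a poly" where
  "f_poly q r B = monom 1 r * pcompose B (monom 1 (q - 1))"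

end

theory Submission
  imports Defs
begin

text \<open>
  Write \<open>D(y)\<close> for \<open>B\<^sub>j(y)\<close>, put \<open>n = Q + R + S\<close> and \<open>N(y) = y\<^sup>n D(1/y)\<close>, and let \<open>\<mu>\<close> be the
  group of elements \<open>y\<close> with \<open>y\<^bsup>q+1\<^esup> = 1\<close> (norm one over the subfield with \<open>q\<close> elements).
  For \<open>x \<noteq> 0\<close> the element \<open>y = x\<^bsup>q-1\<^esup>\<close> lies in \<open>\<mu>\<close>, where
  raising to the power \<open>q\<close> is inversion and \<open>y\<^sup>r = y\<^sup>n\<close>. Hence \<open>f(x) = x\<^sup>r D(y)\<close> and
  \<open>f(x)\<^sup>q = x\<^sup>r N(y)\<close>, so the value \<open>f(x)\<close> determines the ratio \<open>N(y) : D(y)\<close>. If that ratio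
  determines \<open>y\<close>, and \<open>D\<close> has no zero on \<open>\<mu>\<close>, then \<open>f(x)\<close> determines both \<open>x\<^sup>r\<close> and \<open>x\<^bsup>q-1\<^esup>\<close>, and
  therefore \<open>x\<close>, because \<open>r\<close> and \<open>q - 1\<close> are coprime
  (\<open>permutation_poly_criterion\<close>).

  To understand the ratio, take a primitive cube root of unity \<open>\<omega>\<close>; it lies in the field because
  \<open>3\<close> divides \<open>q\<^sup>2 - 1\<close>. For \<open>B\<^sub>1\<close>, with \<open>u = y\<^sup>Q\<close>, \<open>v = y\<^sup>R\<close>, \<open>w = y\<^sup>S\<close>, the combinations
  \<open>N + \<omega> D\<close> and \<open>N + \<omega>\<^sup>2 D\<close> split completely, as constants times \<open>(u + \<omega>)(v + \<omega>)(w + \<omega>)\<close> and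
  \<open>(u + \<omega>\<^sup>2)(v + \<omega>\<^sup>2)(w + \<omega>\<^sup>2)\<close> (\<open>symmetric_form_split\<close>). The other three polynomials reduce to this
  one: substituting \<open>1/w\<close> for \<open>w\<close> and clearing the denominator turns \<open>B\<^sub>1\<close> into \<open>B\<^sub>3\<close>, which exchanges
  \<open>\<omega>\<close> and \<open>\<omega>\<^sup>2\<close> in the third factor, and \<open>y \<mapsto> -y\<close> turns \<open>B\<^sub>1\<close>, \<open>B\<^sub>3\<close> into \<open>B\<^sub>2\<close>, \<open>B\<^sub>4\<close> up to sign.
  The sign \<open>e\<close> below keeps track of the last substitution.

  By Frobenius, \<open>y\<^sup>Q + \<omega>\<close> is \<open>(y + \<omega>)\<^sup>Q\<close> or \<open>(y + \<omega>\<^sup>2)\<^sup>Q\<close> according to \<open>Q\<close> modulo \<open>3\<close>. So in terms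
  of \<open>L(y) = (y + \<omega>) / (y + \<omega>\<^sup>2)\<close> the ratio \<open>N : D\<close> corresponds to a constant times
  \<open>L(y)\<^bsup>A-B\<^esup>\<close>, where \<open>A - B\<close> is up to sign one of \<open>Q \<plusminus> R \<plusminus> S\<close>. Finally \<open>L\<close> carries \<open>\<mu>\<close> into a coset of
  the elements of order dividing \<open>q + 1\<close> if \<open>q \<equiv> 1\<close> modulo \<open>3\<close>, and into a coset of the elements of
  order dividing \<open>q - 1\<close>, together with \<open>0\<close> and \<open>\<infinity>\<close>, if \<open>q \<equiv> -1\<close>. The gcd hypotheses say that the
  power \<open>A - B\<close> is injective there (\<open>mobius_twist_inj\<close>).
\<close>

section \<open>Powers in a finite field\<close>

lemma power_card_minus_one_eq_1:
  fixes x :: "'a :: {field, finite}"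
  assumes "x \<noteq> 0"
  shows "x ^ (card (UNIV :: 'a set) - 1) = 1"
proof -
  let ?U = "UNIV - {0} :: 'a set"
  have "bij_betw ((*) x) ?U ?U"
    using assms by (intro bij_betw_byWitness[where f' = "\<lambda>y. y / x"]) auto
  then have "(\<Prod>y\<in>?U. x * y) = \<Prod>?U"
    by (rule prod.reindex_bij_betw)
  moreover have "(\<Prod>y\<in>?U. x * y) = x ^ card ?U * \<Prod>?U"
    by (simp add: prod.distrib)
  moreover have "\<Prod>?U \<noteq> 0"
    by simp
  moreover have "card ?U = card (UNIV :: 'a set) - 1"
    by (simp add: card_Diff_singleton)
  ultimately show ?thesis
    by (metis mult_cancel_right2)
qed

text \<open>
  If \<open>m\<close> is a third of the order of the multiplicative group, then \<open>X\<^sup>m - 1\<close> has too few roots to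
  kill that group, and the \<open>m\<close>-th power of a nonzero non-root is a nontrivial cube root of unity.
\<close>

lemma exists_primitive_cube_root:
  assumes "3 dvd card (UNIV :: 'a set) - 1"
  obtains \<omega> :: "'a :: {field, finite}" where "\<omega>\<^sup>2 + \<omega> + 1 = 0" "\<omega> \<noteq> 1"
proof -
  define n where "n = card (UNIV :: 'a set)"
  obtain m where m: "n - 1 = 3 * m"
    using assms unfolding n_def by (auto simp: dvd_def)
  have "card {0, 1 :: 'a} \<le> n"
    unfolding n_def by (rule card_mono) auto
  then have n: "n \<ge> 2" by simp
  then have "m > 0" using m by (cases m) auto
  let ?P = "monom 1 m - 1 :: 'a poly"
  have deg: "degree ?P \<le> m"
    by (rule degree_diff_le) (auto simp: degree_monom_le)
  have "coeff ?P m = 1"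
    using \<open>m > 0\<close> by (simp add: coeff_1)
  then have "?P \<noteq> 0" by (metis coeff_0 zero_neq_one)
  then have "card {x. poly ?P x = 0} \<le> m"
    using card_poly_roots_bound deg le_trans by blast
  moreover have "card (UNIV - {0 :: 'a}) = 3 * m"
    using m by (simp add: card_Diff_singleton n_def)
  ultimately have "\<not> UNIV - {0} \<subseteq> {x. poly ?P x = 0}"
    using \<open>m > 0\<close> card_mono[of "{x. poly ?P x = 0}" "UNIV - {0}"] by auto
  then obtain x :: 'a where x: "x \<noteq> 0" "x ^ m \<noteq> 1"
    by (auto simp: poly_monom)
  have "(x ^ m) ^ 3 = 1"
    using power_card_minus_one_eq_1[OF x(1)] m
    by (simp add: n_def power_mult [symmetric] mult.commute)
  then have "(x ^ m - 1) * ((x ^ m)\<^sup>2 + x ^ m + 1) = 0"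
    by (simp add: algebra_simps power2_eq_square power3_eq_cube)
  with x(2) show thesis
    by (intro that[of "x ^ m"]) auto
qed

text \<open>
  Bezout for exponents. Integer exponents make the lemma insensitive to the sign of \<open>A - B\<close>.
\<close>

lemma eq_1_if_coprime_powers:
  fixes \<rho> :: "'a :: field"
  assumes "\<rho> \<noteq> 0" "\<rho> ^ A = \<rho> ^ B" "\<rho> powi m = 1" "gcd (int A - int B) m = 1"
  shows "\<rho> = 1"
proof -
  obtain u v where uv: "u * (int A - int B) + v * m = 1"
    using bezout_int[of "int A - int B" m] assms(4) by auto
  have "\<rho> powi (int A - int B) = 1"
    using assms(1,2) by (simp add: power_int_diff)
  then have "\<rho> powi ((int A - int B) * u + m * v) = 1"
    using assms(1,3) by (simp add: power_int_add power_int_mult)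
  with uv show ?thesis
    by (simp add: mult.commute)
qed

lemma residue3_cong_int:
  "[int n = 1] (mod 3) \<longleftrightarrow> n mod 3 = 1"
  "[int n = - 1] (mod 3) \<longleftrightarrow> n mod 3 = 2"
  using of_nat_mod[of n 3, where 'a = int] by (auto simp: cong_def)

section \<open>The two trilinear forms\<close>

text \<open>
  With \<open>e = 1\<close> and \<open>e = -1\<close> the form \<open>uvw - u - v - w + e\<close> yields \<open>B\<^sub>1\<close> and \<open>B\<^sub>2\<close>, and
  \<open>uv - uw - vw + ew - 1\<close> yields \<open>B\<^sub>3\<close> and \<open>B\<^sub>4\<close>. The first two lemmas compute the numerator \<open>N\<close>: the
  capital letters stand for the \<open>q\<close>-th powers, which are inverses of the small ones.
\<close>

lemma symmetric_form_reciprocal: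
  fixes u v w U V W e :: "'a :: field"
  assumes "u * U = 1" "v * V = 1" "w * W = 1"
  shows "(u * v * w) * (U * V * W - U - V - W + e) = e * (u * v * w) - v * w - u * w - u * v + 1"
  using assms by algebra

lemma inverted_form_reciprocal:
  fixes u v w U V W e :: "'a :: field"
  assumes "u * U = 1" "v * V = 1" "w * W = 1"
  shows "(u * v * w) * (U * V - U * W - V * W + e * W - 1) = w - v - u + e * (u * v) - u * v * w"
  using assms by algebra

text \<open>
  Take \<open>e = 1\<close> and characteristic other than \<open>3\<close>. On the diagonal \<open>u = v = w\<close> the cubic map \<open>N/D\<close> is
  totally ramified over \<open>-\<omega>\<close> and \<open>-\<omega>\<^sup>2\<close>, so that it is cubing up to Moebius transformations of source and
  target; the identity below is the polarization of this.
  The case \<open>e = -1\<close> is the substitution \<open>u, v, w \<mapsto> -u, -v, -w\<close>.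
\<close>

lemma symmetric_form_split:
  fixes u v w e \<omega> :: "'a :: field"
  assumes "\<omega>\<^sup>2 + \<omega> + 1 = 0" "e * e = 1"
  shows "(e * (u * v * w) - v * w - u * w - u * v + 1) + e * \<omega> * (u * v * w - u - v - w + e)
           = - (\<omega>\<^sup>2) * ((e * u + \<omega>) * (e * v + \<omega>) * (e * w + \<omega>))"
  using assms by algebra

text \<open>
  Replacing \<open>w\<close> by its inverse in the symmetric form turns \<open>w + \<omega>\<close> into \<open>\<omega> (w + \<omega>\<^sup>2) / w\<close>, hence the
  different last factor.
\<close>

lemma inverted_form_split:
  fixes u v w e \<omega> :: "'a :: field"
  assumes "\<omega>\<^sup>2 + \<omega> + 1 = 0" "e * e = 1"
  shows "(w - v - u + e * (u * v) - u * v * w) + e * \<omega> * (u * v - u * w - v * w + e * w - 1)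
           = - e * ((e * u + \<omega>) * (e * v + \<omega>) * (e * w + \<omega>\<^sup>2))"
  using assms by algebra

section \<open>Frobenius and cube roots of unity\<close>

text \<open>
  For a power \<open>n\<close> of \<open>p\<close>, exactly one of these is \<open>n\<close> and the other is \<open>0\<close>. They are the multiplicities
  of \<open>x + \<omega>\<close> and \<open>x + \<omega>\<^sup>2\<close> in \<open>x\<^sup>n + \<omega>\<close>, since the \<open>n\<close>-th power map either fixes \<open>\<omega>\<close> or exchanges it with
  \<open>\<omega>\<^sup>2\<close>.
\<close>

definition pos_part3 :: "nat \<Rightarrow> nat" where
  "pos_part3 n = (if n mod 3 = 1 then n else 0)"

definition neg_part3 :: "nat \<Rightarrow> nat" where
  "neg_part3 n = (if n mod 3 = 1 then 0 else n)"

locale quadratic_field_with_cube_root =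
  fixes p k q :: nat and \<omega> :: "'a :: {field, finite}"
  assumes p: "prime p" "p \<noteq> 3" and k: "k > 0" and q: "q = p ^ k"
    and card_field: "card (UNIV :: 'a set) = q\<^sup>2"
    and \<omega>: "\<omega>\<^sup>2 + \<omega> + 1 = 0" "\<omega> \<noteq> 1"
begin

lemma q_gt_1: "q > 1"
  unfolding q using p k by (intro one_less_power) (auto dest: prime_gt_1_nat)

lemma CHAR_eq: "CHAR('a) = p"
proof -
  have pr: "prime CHAR('a)"
    by (rule prime_CHAR_semidom) (rule finite_imp_CHAR_pos, simp)
  have "of_nat (card (UNIV :: 'a set)) = (0 :: 'a)"
  proof -
    have "(\<Sum>x\<in>UNIV. x + 1) = (\<Sum>x\<in>(UNIV :: 'a set). x)"
      by (intro sum.reindex_bij_betw bij_betw_byWitness[where f' = "\<lambda>x. x - 1"]) auto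
    then show ?thesis
      by (simp add: sum.distrib)
  qed
  then have "CHAR('a) dvd p ^ (k * 2)"
    by (simp add: of_nat_eq_0_iff_char_dvd card_field q power_mult del: of_nat_power)
  with pr have "CHAR('a) dvd p"
    using prime_dvd_power by blast
  with pr p show ?thesis
    by (simp add: primes_dvd_imp_eq)
qed

lemma frobenius_add: "(x + y) ^ (p ^ i) = x ^ (p ^ i) + (y :: 'a) ^ (p ^ i)"
  by (rule freshmans_dream') (use p CHAR_eq in auto)

lemma frobenius_minus: "(- x) ^ (p ^ i) = - ((x :: 'a) ^ (p ^ i))"
proof -
  have "x ^ (p ^ i) + (- x) ^ (p ^ i) = 0"
    using frobenius_add[of x "- x" i] p by (simp add: power_0_left prime_gt_0_nat)
  then show ?thesis
    by (simp add: add_eq_0_iff)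
qed

lemma frobenius_diff: "(x - y) ^ (p ^ i) = x ^ (p ^ i) - (y :: 'a) ^ (p ^ i)"
  using frobenius_add[of x "- y" i] frobenius_minus[of y i] by simp

text \<open>In characteristic \<open>2\<close>, where the exponent may be even, this rests on \<open>-1 = 1\<close>.\<close>

lemma frobenius_sign:
  assumes "e = 1 \<or> e = (- 1 :: 'a)"
  shows "e ^ (p ^ i) = e"
  using assms frobenius_minus[of 1 i] by auto

lemma frobenius_q:
  fixes x y :: 'a
  shows "(x + y) ^ q = x ^ q + y ^ q" and "(x - y) ^ q = x ^ q - y ^ q"
    and "e = 1 \<or> e = (- 1 :: 'a) \<Longrightarrow> e ^ q = e"
  using frobenius_add[of x y k] frobenius_diff[of x y k] frobenius_sign[of e k] by (auto simp: q)

lemma omega_cube: "\<omega> ^ 3 = 1"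
  using \<omega>(1) by algebra

lemma omega_square_neq: "\<omega>\<^sup>2 \<noteq> \<omega>"
  using \<omega> by (auto simp: power2_eq_square)

lemma omega_power_mod_3: "\<omega> ^ n = \<omega> ^ (n mod 3)"
proof -
  have "\<omega> ^ n = \<omega> ^ (3 * (n div 3) + n mod 3)"
    by simp
  also have "\<dots> = \<omega> ^ (n mod 3)"
    by (simp only: power_add power_mult omega_cube) simp
  finally show ?thesis .
qed

lemma prime_power_mod_3: "p ^ i mod 3 = 1 \<or> p ^ i mod 3 = 2"
proof -
  have "\<not> 3 dvd p ^ i"
    using p prime_dvd_power[of 3 p i] primes_dvd_imp_eq[of 3 p] by auto
  then show ?thesis
    by presburger
qed

lemma omega_prime_power:
  "\<omega> ^ (p ^ i) = (if p ^ i mod 3 = 1 then \<omega> else \<omega>\<^sup>2)"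
  "(\<omega>\<^sup>2) ^ (p ^ i) = (if p ^ i mod 3 = 1 then \<omega>\<^sup>2 else \<omega>)"
proof -
  show *: "\<omega> ^ (p ^ i) = (if p ^ i mod 3 = 1 then \<omega> else \<omega>\<^sup>2)"
    using omega_power_mod_3[of "p ^ i"] prime_power_mod_3[of i] by auto
  have "(\<omega>\<^sup>2) ^ (p ^ i) = (\<omega> ^ (p ^ i))\<^sup>2"
    by (simp only: power_mult [symmetric] mult.commute)
  then show "(\<omega>\<^sup>2) ^ (p ^ i) = (if p ^ i mod 3 = 1 then \<omega>\<^sup>2 else \<omega>)"
    using * omega_power_mod_3[of 4] by (simp add: power_mult [symmetric])
qed

lemmas omega_power_q = omega_prime_power[of k, folded q]

lemma frobenius_add_omega:
  "x ^ (p ^ i) + \<omega> = (x + \<omega>) ^ pos_part3 (p ^ i) * (x + \<omega>\<^sup>2) ^ neg_part3 (p ^ i)"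
  "x ^ (p ^ i) + \<omega>\<^sup>2 = (x + \<omega>\<^sup>2) ^ pos_part3 (p ^ i) * (x + \<omega>) ^ neg_part3 (p ^ i)"
  by (simp_all add: pos_part3_def neg_part3_def frobenius_add omega_prime_power del: power_mult)

section \<open>Injectivity on the norm-one group\<close>

text \<open>
  These conditions make the power \<open>A - B\<close> injective on the image of the norm-one group under
  \<open>y \<mapsto> (y + \<omega>) / (y + \<omega>\<^sup>2)\<close>. For \<open>q \<equiv> 2\<close> modulo \<open>3\<close> that image contains \<open>0\<close> and \<open>\<infinity>\<close>, and
  \<open>L\<^sup>A / L\<^sup>B\<close> must still be meaningful there when computed as a ratio of products, which is why one of the
  exponents has to vanish. The condition \<open>A + B > 0\<close> matters only for \<open>q = 2\<close>, where
  \<open>gcd 0 (q - 1) = 1\<close>.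
\<close>

definition admissible :: "nat \<Rightarrow> nat \<Rightarrow> bool" where
  "admissible A B \<longleftrightarrow> A + B > 0 \<and>
     (q mod 3 = 1 \<and> gcd (int A - int B) (int q + 1) = 1 \<or>
      q mod 3 = 2 \<and> (A = 0 \<or> B = 0) \<and> gcd (int A - int B) (int q - 1) = 1)"

text \<open>
  For \<open>q \<equiv> 1\<close> modulo \<open>3\<close> the points \<open>-\<omega>\<close> and \<open>-\<omega>\<^sup>2\<close> do not have norm one, so neither factor vanishes.
  Otherwise they do, but each of the two products is then a power of a single factor, and the two factors
  have no common zero.
\<close>

lemma twist_nonzero:
  fixes x :: 'a
  assumes x: "x ^ (q + 1) = 1" and adm: "admissible A B"
  shows "(x + \<omega>) ^ A * (x + \<omega>\<^sup>2) ^ B \<noteq> 0 \<or> (x + \<omega>\<^sup>2) ^ A * (x + \<omega>) ^ B \<noteq> 0"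
proof (cases "q mod 3 = 1")
  case True
  have minus_q: "(- z) ^ q = - (z ^ q)" for z :: 'a
    using frobenius_minus[of z k] by (simp add: q)
  have "x + \<omega> \<noteq> 0"
  proof
    assume "x + \<omega> = 0"
    then have "x = - \<omega>" by (simp add: add_eq_0_iff2)
    then have "\<omega> * \<omega> = 1"
      using x True by (simp add: minus_q omega_power_q)
    then show False
      using omega_square_neq omega_cube \<omega>(2) by (simp add: power3_eq_cube)
  qed
  moreover have "x + \<omega>\<^sup>2 \<noteq> 0"
  proof
    assume "x + \<omega>\<^sup>2 = 0"
    then have "x = - (\<omega>\<^sup>2)" by (simp add: add_eq_0_iff2)
    then have "\<omega> * \<omega> ^ 3 = 1"
      using x True omega_power_q(2) by (simp add: minus_q power2_eq_square power3_eq_cube mult.assoc)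
    then show False
      using omega_cube \<omega>(2) by (simp only: mult_1_right)
  qed
  ultimately show ?thesis by simp
next
  case False
  then have "A = 0 \<and> B > 0 \<or> A > 0 \<and> B = 0"
    using adm by (auto simp: admissible_def)
  moreover have "x + \<omega> \<noteq> 0 \<or> x + \<omega>\<^sup>2 \<noteq> 0"
    using omega_square_neq by (metis add_left_cancel)
  ultimately show ?thesis by auto
qed

text \<open>
  The equation says \<open>L(x)\<^bsup>A-B\<^esup> = L(y)\<^bsup>A-B\<^esup>\<close> for \<open>L(z) = (z + \<omega>) / (z + \<omega>\<^sup>2)\<close>, in a form that also makes
  sense at \<open>0\<close> and \<open>\<infinity>\<close>. With \<open>\<rho> = L(x) / L(y)\<close>, conjugation \<open>z \<mapsto> z\<^sup>q\<close> sends \<open>\<rho>\<close> to its inverse if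
  it fixes \<open>\<omega>\<close>, and fixes \<open>\<rho>\<close> if it exchanges \<open>\<omega>\<close> and \<open>\<omega>\<^sup>2\<close>. So \<open>\<rho>\<close> has order dividing \<open>q + 1\<close> or
  \<open>q - 1\<close>, and the coprimality in admissibility gives \<open>\<rho> = 1\<close>.
\<close>

lemma mobius_twist_inj:
  fixes x y :: 'a
  assumes x: "x ^ (q + 1) = 1" and y: "y ^ (q + 1) = 1" and adm: "admissible A B"
    and eq: "((x + \<omega>) ^ A * (x + \<omega>\<^sup>2) ^ B) * ((y + \<omega>\<^sup>2) ^ A * (y + \<omega>) ^ B) =
             ((x + \<omega>\<^sup>2) ^ A * (x + \<omega>) ^ B) * ((y + \<omega>) ^ A * (y + \<omega>\<^sup>2) ^ B)"
  shows "x = y"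
proof -
  \<comment> \<open>numerator and denominator of \<open>L(x) / L(y)\<close>\<close>
  define a b where "a = (x + \<omega>) * (y + \<omega>\<^sup>2)" and "b = (x + \<omega>\<^sup>2) * (y + \<omega>)"
  have eq': "a ^ A * b ^ B = b ^ A * a ^ B"
    using eq by (simp add: a_def b_def power_mult_distrib mult_ac)
  have "a - b = (\<omega>\<^sup>2 - \<omega>) * (x - y)"
    by (simp add: a_def b_def algebra_simps power2_eq_square)
  then have ab: "x = y" if "a = b"
    using that omega_square_neq by auto
  have x0: "x \<noteq> 0" "y \<noteq> 0"
    using x y by (auto simp: power_0_left)
  have xq: "x ^ q = 1 / x" "y ^ q = 1 / y"
    using x y x0 by (auto simp: field_simps)
  have "\<omega> * \<omega>\<^sup>2 = 1"
    using omega_cube by (simp add: power2_eq_square power3_eq_cube mult.assoc)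
  have aq: "x * y * a ^ q = (1 + x * \<omega> ^ q) * (1 + y * (\<omega>\<^sup>2) ^ q)"
    and bq: "x * y * b ^ q = (1 + x * (\<omega>\<^sup>2) ^ q) * (1 + y * \<omega> ^ q)"
    using x0 by (simp_all add: a_def b_def power_mult_distrib frobenius_q(1) xq field_simps)
  have reflect: "1 + z * \<omega> = \<omega> * (z + \<omega>\<^sup>2)" "1 + z * \<omega>\<^sup>2 = \<omega>\<^sup>2 * (z + \<omega>)" for z
    using \<open>\<omega> * \<omega>\<^sup>2 = 1\<close> by (simp_all add: algebra_simps)
  have cancel: "(\<omega> * u) * (\<omega>\<^sup>2 * v) = u * v" "(\<omega>\<^sup>2 * u) * (\<omega> * v) = u * v" for u v
    using \<open>\<omega> * \<omega>\<^sup>2 = 1\<close> by algebra+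
  have swap: "x * y * a ^ q = b" "x * y * b ^ q = a" if "q mod 3 = 1"
    using aq bq that by (simp_all only: omega_power_q refl if_True reflect cancel a_def b_def)
  have fixed: "x * y * a ^ q = a" "x * y * b ^ q = b" if "q mod 3 = 2"
    using aq bq that by (simp_all add: omega_power_q reflect cancel a_def b_def)
  have q3: "q mod 3 = 1 \<or> q mod 3 = 2"
    using adm by (auto simp: admissible_def)
  \<comment> \<open>disposes of the degenerate values, so that the quotient can be formed\<close>
  then have "a = 0 \<longleftrightarrow> b = 0"
  proof
    assume q1: "q mod 3 = 1"
    then show ?thesis
      using swap q_gt_1 by (metis mult_zero_right power_0_left not_one_less_zero)
  next
    assume "q mod 3 = 2"
    then have "A = 0 \<and> B > 0 \<or> A > 0 \<and> B = 0"
      using adm by (auto simp: admissible_def)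
    then show ?thesis
      using eq' by (metis mult_1 mult_1_right power_0 power_eq_0_iff)
  qed
  then consider "a = b" | "a \<noteq> 0" "b \<noteq> 0"
    by auto
  then show ?thesis
  proof cases
    case 1
    then show ?thesis by (rule ab)
  next
    case 2
    define \<rho> where "\<rho> = a / b"
    have \<rho>: "\<rho> \<noteq> 0" "\<rho> ^ A = \<rho> ^ B"
      using 2 eq' by (simp_all add: \<rho>_def power_divide field_simps)
    have "\<rho> = 1"
      using q3
    proof
      assume q1: "q mod 3 = 1"
      then have "a ^ q * a = b ^ q * b"
        using swap by (metis mult.commute mult.left_commute)
      then have "\<rho> powi int (q + 1) = 1"
        using 2 unfolding power_int_of_nat by (simp add: \<rho>_def power_divide mult.commute)
      then show ?thesis
        using eq_1_if_coprime_powers[OF \<rho>, of "int q + 1"] adm q1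
        by (auto simp: admissible_def add.commute)
    next
      assume q2: "q mod 3 = 2"
      then have "a ^ q * b = b ^ q * a"
        using fixed by (metis mult.commute mult.left_commute)
      then have "\<rho> ^ q = \<rho>"
        using 2 by (simp add: \<rho>_def power_divide field_simps)
      then have "\<rho> powi (int q - 1) = 1"
        using \<rho>(1) by (simp add: power_int_diff)
      then show ?thesis
        using eq_1_if_coprime_powers[OF \<rho>, of "int q - 1"] adm q2
        by (auto simp: admissible_def)
    qed
    then show ?thesis
      using 2 ab by (simp add: \<rho>_def)
  qed
qed

text \<open>
  From \<open>f(x) = x\<^sup>r D(y)\<close> and \<open>f(x)\<^sup>q = x\<^sup>r N(y)\<close>, with \<open>y = x\<^bsup>q-1\<^esup>\<close>, the value \<open>f(x)\<close> fixes
  the ratio of any two linear combinations of \<open>N(y)\<close> and \<open>D(y)\<close>. The two given by the hypotheses are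
  those to which the injectivity of the twisted Moebius map applies, and the same factorizations show that \<open>D\<close> has
  no zero of norm one: such a zero would be a zero of \<open>N\<close>, hence of both products.
\<close>

lemma permutation_poly_criterion:
  fixes B :: "'a poly" and N :: "'a \<Rightarrow> 'a" and e c\<^sub>1 c\<^sub>2 d\<^sub>1 d\<^sub>2 :: 'a
  assumes e: "e = 1 \<or> e = - 1" and r: "r > 0" "gcd r (q - 1) = 1"
    and N: "\<And>y. y ^ (q + 1) = 1 \<Longrightarrow> y ^ r * poly B y ^ q = N y"
    and c: "c\<^sub>1 \<noteq> 0" "c\<^sub>2 \<noteq> 0"
    and fac\<^sub>1: "\<And>y. N y + d\<^sub>1 * poly B y = c\<^sub>1 * ((e * y + \<omega>) ^ A * (e * y + \<omega>\<^sup>2) ^ A')"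
    and fac\<^sub>2: "\<And>y. N y + d\<^sub>2 * poly B y = c\<^sub>2 * ((e * y + \<omega>\<^sup>2) ^ A * (e * y + \<omega>) ^ A')"
    and adm: "admissible A A'"
  shows "permutation_poly (f_poly q r B)"
proof -
  define f where "f = poly (f_poly q r B)"
  have f: "f x = x ^ r * poly B (x ^ (q - 1))" for x
    by (simp add: f_def f_poly_def poly_pcompose poly_monom)
  have unit: "(x ^ (q - 1)) ^ (q + 1) = 1" if "x \<noteq> 0" for x :: 'a
  proof -
    have "(q - 1) * (q + 1) = q\<^sup>2 - 1"
      using q_gt_1 by (simp add: power2_eq_square algebra_simps)
    then show ?thesis
      using power_card_minus_one_eq_1[OF that] by (simp only: power_mult [symmetric] card_field)
  qed
  have e_unit: "(e * y) ^ (q + 1) = 1" if "y ^ (q + 1) = 1" for y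
    using that frobenius_sign[OF e, of k] e by (auto simp: power_mult_distrib q)
  have fq: "f x ^ q = x ^ r * N (x ^ (q - 1))" if "x \<noteq> 0" for x
  proof -
    have "(x ^ r) ^ q = x ^ r * (x ^ (q - 1)) ^ r"
      using q_gt_1 by (cases q) (simp_all add: power_mult [symmetric] power_add [symmetric] algebra_simps)
    then show ?thesis
      using N[OF unit[OF that]] by (simp add: f power_mult_distrib mult.assoc)
  qed
  have B_nz: "poly B y \<noteq> 0" if y: "y ^ (q + 1) = 1" for y
  proof
    assume "poly B y = 0"
    moreover from this have "N y = 0"
      using N[OF y] q_gt_1 by (simp add: power_0_left)
    ultimately have "(e * y + \<omega>) ^ A * (e * y + \<omega>\<^sup>2) ^ A' = 0"
      "(e * y + \<omega>\<^sup>2) ^ A * (e * y + \<omega>) ^ A' = 0"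
      using fac\<^sub>1[of y] fac\<^sub>2[of y] c by auto
    with twist_nonzero[OF e_unit[OF y] adm] show False
      by auto
  qed
  have f_nz: "f x \<noteq> 0" if "x \<noteq> 0" for x
    using B_nz[OF unit[OF that]] that by (simp add: f)
  have "inj f"
  proof (rule injI)
    fix x y assume eq: "f x = f y"
    show "x = y"
    proof (cases "x = 0 \<or> y = 0")
      case True
      moreover have "f 0 = 0"
        using r by (simp add: f power_0_left)
      ultimately show ?thesis
        using eq f_nz by metis
    next
      case False
      then have nz: "x \<noteq> 0" "y \<noteq> 0" by auto
      define u v where "u = x ^ (q - 1)" and "v = y ^ (q - 1)"
      have uv: "u ^ (q + 1) = 1" "v ^ (q + 1) = 1"
        using unit nz by (simp_all add: u_def v_def)
      have D: "x ^ r * poly B u = y ^ r * poly B v"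
        using eq by (simp add: f u_def v_def)
      have N': "x ^ r * N u = y ^ r * N v"
        using eq fq[OF nz(1)] fq[OF nz(2)] by (simp add: u_def v_def)
      have comb: "x ^ r * (N u + d * poly B u) = y ^ r * (N v + d * poly B v)" for d
        using D N' by (simp add: distrib_left mult.left_commute[of _ d])
      \<comment> \<open>cross-multiplied equality of the two ratios, valid without knowing which factors vanish\<close>
      have "x ^ r * y ^ r * ((N u + d\<^sub>1 * poly B u) * (N v + d\<^sub>2 * poly B v)) =
            x ^ r * y ^ r * ((N u + d\<^sub>2 * poly B u) * (N v + d\<^sub>1 * poly B v))"
        (is "?X * ?Y * (?P * ?S) = ?X * ?Y * (?R * ?T)")
      proof -
        have "?X * ?Y * (?P * ?S) = (?X * ?P) * (?Y * ?S)"
          by (simp only: mult_ac)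
        also have "\<dots> = (?Y * ?T) * (?X * ?R)"
          by (simp only: comb)
        also have "\<dots> = ?X * ?Y * (?R * ?T)"
          by (simp only: mult_ac)
        finally show ?thesis .
      qed
      then have "(N u + d\<^sub>1 * poly B u) * (N v + d\<^sub>2 * poly B v) =
            (N u + d\<^sub>2 * poly B u) * (N v + d\<^sub>1 * poly B v)"
        using nz by simp
      then have "c\<^sub>1 * c\<^sub>2 * (((e * u + \<omega>) ^ A * (e * u + \<omega>\<^sup>2) ^ A') *
                              ((e * v + \<omega>\<^sup>2) ^ A * (e * v + \<omega>) ^ A')) =
                 c\<^sub>1 * c\<^sub>2 * (((e * u + \<omega>\<^sup>2) ^ A * (e * u + \<omega>) ^ A') *
                              ((e * v + \<omega>) ^ A * (e * v + \<omega>\<^sup>2) ^ A'))"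
        unfolding fac\<^sub>1 fac\<^sub>2 by (simp only: mult_ac)
      then have "e * u = e * v"
        using c by (intro mobius_twist_inj[OF e_unit[OF uv(1)] e_unit[OF uv(2)] adm]) simp
      then have "u = v" using e by auto
      then have "x ^ r = y ^ r"
        using D B_nz[OF uv(1)] by simp
      then have "(x / y) ^ r = (x / y) ^ 0"
        using nz by (simp add: power_divide)
      moreover have "(x / y) powi int (q - 1) = 1"
        using \<open>u = v\<close> nz unfolding power_int_of_nat by (simp add: u_def v_def power_divide)
      ultimately have "x / y = 1"
        using nz r by (intro eq_1_if_coprime_powers[of "x / y" r 0 "int (q - 1)"])
          (auto simp: gcd_int_int_eq)
      then show ?thesis
        using nz by simp
    qed
  qed
  then show ?thesis
    unfolding permutation_poly_def f_def by (simp add: bij_def finite_UNIV_inj_surj)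
qed

section \<open>The two families of polynomials\<close>

lemma power_times_conjugate:
  fixes y :: 'a
  assumes y: "y ^ (q + 1) = 1"
  shows "y ^ (p ^ i) * (y ^ (p ^ i)) ^ q = 1"
proof -
  have "y ^ (p ^ i) * (y ^ (p ^ i)) ^ q = (y ^ (q + 1)) ^ (p ^ i)"
    by (simp only: power_mult [symmetric] power_add [symmetric]) (simp add: algebra_simps)
  then show ?thesis
    using y by simp
qed

lemma power_cong_unit:
  fixes y :: 'a
  assumes "y ^ (q + 1) = 1" and "[m = n] (mod (q + 1))"
  shows "y ^ m = y ^ n"
proof -
  have *: "y ^ l = y ^ (l mod (q + 1))" for l
  proof -
    have "y ^ l = y ^ ((q + 1) * (l div (q + 1)) + l mod (q + 1))"
      by (simp only: mult_div_mod_eq)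
    then show ?thesis
      by (simp only: power_add[of y "_ * _"] power_mult assms(1)) simp
  qed
  from *[of m] *[of n] assms(2) show ?thesis
    by (simp add: cong_def)
qed

context
  fixes e :: 'a and i j l Q R S r :: nat
  assumes e: "e = 1 \<or> e = - 1"
    and Q: "Q = p ^ i" and R: "R = p ^ j" and S: "S = p ^ l"
    and r: "r > 0" "gcd r (q - 1) = 1" "[r = Q + R + S] (mod (q + 1))"
begin

lemma signed_powers: "(e * y) ^ Q = e * y ^ Q" "(e * y) ^ R = e * y ^ R" "(e * y) ^ S = e * y ^ S"
  by (simp_all add: power_mult_distrib Q R S frobenius_sign[OF e])

lemma monomials_times_conjugates:
  assumes y: "y ^ (q + 1) = (1 :: 'a)"
  shows "y ^ Q * (y ^ Q) ^ q = 1" "y ^ R * (y ^ R) ^ q = 1" "y ^ S * (y ^ S) ^ q = 1"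
  using power_times_conjugate[OF y] by (simp_all only: Q R S)

text \<open>
  All three factors contribute their exponent with the same rule, so \<open>A - B\<close> is the sum of
  \<open>Q\<close>, \<open>R\<close>, \<open>S\<close>, each with the sign given by its residue modulo \<open>3\<close>.
\<close>

lemma permutation_poly_symmetric:
  fixes B :: "'a poly"
  assumes B: "\<And>y. poly B y = y ^ Q * y ^ R * y ^ S - y ^ Q - y ^ R - y ^ S + e"
    and adm: "admissible (pos_part3 Q + pos_part3 R + pos_part3 S)
                         (neg_part3 Q + neg_part3 R + neg_part3 S)"
  shows "permutation_poly (f_poly q r B)"
proof -
  define N where "N y = e * (y ^ Q * y ^ R * y ^ S) - y ^ R * y ^ S - y ^ Q * y ^ S - y ^ Q * y ^ R + 1"
    for y :: 'a
  have ee: "e * e = 1" using e by auto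
  \<comment> \<open>the second splitting is the first one for the conjugate root \<open>\<omega>\<^sup>2\<close>\<close>
  have \<omega>': "(\<omega>\<^sup>2)\<^sup>2 + \<omega>\<^sup>2 + 1 = 0" "(\<omega>\<^sup>2)\<^sup>2 = \<omega>"
    using \<omega>(1) by algebra+
  have split: "(z + \<omega>) ^ (pos_part3 Q + pos_part3 R + pos_part3 S) *
      (z + \<omega>\<^sup>2) ^ (neg_part3 Q + neg_part3 R + neg_part3 S) = (z ^ Q + \<omega>) * (z ^ R + \<omega>) * (z ^ S + \<omega>)"
    "(z + \<omega>\<^sup>2) ^ (pos_part3 Q + pos_part3 R + pos_part3 S) *
      (z + \<omega>) ^ (neg_part3 Q + neg_part3 R + neg_part3 S) = (z ^ Q + \<omega>\<^sup>2) * (z ^ R + \<omega>\<^sup>2) * (z ^ S + \<omega>\<^sup>2)"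
    for z :: 'a
    by (simp_all only: Q R S frobenius_add_omega power_add mult_ac)
  show ?thesis
  proof (rule permutation_poly_criterion[where e = e and N = N and c\<^sub>1 = "- (\<omega>\<^sup>2)" and c\<^sub>2 = "- \<omega>"
        and d\<^sub>1 = "e * \<omega>" and d\<^sub>2 = "e * \<omega>\<^sup>2", OF e r(1,2) _ _ _ _ _ adm])
    fix y :: 'a assume y: "y ^ (q + 1) = 1"
    have "y ^ r = y ^ Q * y ^ R * y ^ S"
      using power_cong_unit[OF y r(3)] by (simp add: power_add)
    moreover have "poly B y ^ q = (y ^ Q) ^ q * (y ^ R) ^ q * (y ^ S) ^ q
        - (y ^ Q) ^ q - (y ^ R) ^ q - (y ^ S) ^ q + e"
      by (simp only: B frobenius_q(1,2) frobenius_q(3)[OF e] power_mult_distrib)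
    ultimately show "y ^ r * poly B y ^ q = N y"
      by (simp only: N_def symmetric_form_reciprocal[OF monomials_times_conjugates[OF y]])
  next
    show "- (\<omega>\<^sup>2) \<noteq> 0" "- \<omega> \<noteq> 0"
      using \<omega> by auto
  next
    fix y :: 'a
    show "N y + e * \<omega> * poly B y = - (\<omega>\<^sup>2) * ((e * y + \<omega>) ^ (pos_part3 Q + pos_part3 R + pos_part3 S) *
      (e * y + \<omega>\<^sup>2) ^ (neg_part3 Q + neg_part3 R + neg_part3 S))"
      unfolding split signed_powers B N_def by (rule symmetric_form_split[OF \<omega>(1) ee])
    show "N y + e * \<omega>\<^sup>2 * poly B y = - \<omega> * ((e * y + \<omega>\<^sup>2) ^ (pos_part3 Q + pos_part3 R + pos_part3 S) *
      (e * y + \<omega>) ^ (neg_part3 Q + neg_part3 R + neg_part3 S))"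
      unfolding split signed_powers B N_def using symmetric_form_split[OF \<omega>'(1) ee] by (simp only: \<omega>'(2))
  qed
qed

text \<open>
  The third factor of the split form has \<open>\<omega>\<^sup>2\<close> in place of \<open>\<omega>\<close>, so \<open>S\<close> enters \<open>A - B\<close> with the opposite
  sign. This is why the sign patterns for \<open>B\<^sub>3\<close> and \<open>B\<^sub>4\<close> are those for \<open>B\<^sub>1\<close> and \<open>B\<^sub>2\<close> with \<open>S\<close>
  negated; as the form is no longer symmetric in all three variables, the mixed pattern splits in two.
\<close>

lemma permutation_poly_inverted:
  fixes B :: "'a poly"
  assumes B: "\<And>y. poly B y = y ^ Q * y ^ R - y ^ Q * y ^ S - y ^ R * y ^ S + e * y ^ S - 1"
    and adm: "admissible (pos_part3 Q + pos_part3 R + neg_part3 S)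
                         (neg_part3 Q + neg_part3 R + pos_part3 S)"
  shows "permutation_poly (f_poly q r B)"
proof -
  define N where "N y = y ^ S - y ^ R - y ^ Q + e * (y ^ Q * y ^ R) - y ^ Q * y ^ R * y ^ S"
    for y :: 'a
  have ee: "e * e = 1" using e by auto
  \<comment> \<open>the second splitting is the first one for the conjugate root \<open>\<omega>\<^sup>2\<close>\<close>
  have \<omega>': "(\<omega>\<^sup>2)\<^sup>2 + \<omega>\<^sup>2 + 1 = 0" "(\<omega>\<^sup>2)\<^sup>2 = \<omega>"
    using \<omega>(1) by algebra+
  have split: "(z + \<omega>) ^ (pos_part3 Q + pos_part3 R + neg_part3 S) *
      (z + \<omega>\<^sup>2) ^ (neg_part3 Q + neg_part3 R + pos_part3 S) = (z ^ Q + \<omega>) * (z ^ R + \<omega>) * (z ^ S + \<omega>\<^sup>2)"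
    "(z + \<omega>\<^sup>2) ^ (pos_part3 Q + pos_part3 R + neg_part3 S) *
      (z + \<omega>) ^ (neg_part3 Q + neg_part3 R + pos_part3 S) = (z ^ Q + \<omega>\<^sup>2) * (z ^ R + \<omega>\<^sup>2) * (z ^ S + \<omega>)"
    for z :: 'a
    by (simp_all only: Q R S frobenius_add_omega power_add mult_ac)
  show ?thesis
  proof (rule permutation_poly_criterion[where e = e and N = N and c\<^sub>1 = "- e" and c\<^sub>2 = "- e"
        and d\<^sub>1 = "e * \<omega>" and d\<^sub>2 = "e * \<omega>\<^sup>2", OF e r(1,2) _ _ _ _ _ adm])
    fix y :: 'a assume y: "y ^ (q + 1) = 1"
    have "y ^ r = y ^ Q * y ^ R * y ^ S"
      using power_cong_unit[OF y r(3)] by (simp add: power_add)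
    moreover have "poly B y ^ q = (y ^ Q) ^ q * (y ^ R) ^ q - (y ^ Q) ^ q * (y ^ S) ^ q
        - (y ^ R) ^ q * (y ^ S) ^ q + e * (y ^ S) ^ q - 1"
      by (simp only: B frobenius_q(1,2) frobenius_q(3)[OF e] power_mult_distrib power_one)
    ultimately show "y ^ r * poly B y ^ q = N y"
      by (simp only: N_def inverted_form_reciprocal[OF monomials_times_conjugates[OF y]])
  next
    show "- e \<noteq> 0" "- e \<noteq> 0"
      using e by auto
  next
    fix y :: 'a
    show "N y + e * \<omega> * poly B y = - e * ((e * y + \<omega>) ^ (pos_part3 Q + pos_part3 R + neg_part3 S) *
      (e * y + \<omega>\<^sup>2) ^ (neg_part3 Q + neg_part3 R + pos_part3 S))"
      unfolding split signed_powers B N_def by (rule inverted_form_split[OF \<omega>(1) ee])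
    show "N y + e * \<omega>\<^sup>2 * poly B y = - e * ((e * y + \<omega>\<^sup>2) ^ (pos_part3 Q + pos_part3 R + neg_part3 S) *
      (e * y + \<omega>) ^ (neg_part3 Q + neg_part3 R + pos_part3 S))"
      unfolding split signed_powers B N_def using inverted_form_split[OF \<omega>'(1) ee] by (simp only: \<omega>'(2))
  qed
qed

end

text \<open>
  Changing the common sign \<open>s\<close> of the residues exchanges \<open>A\<close> and \<open>B\<close>, hence the freedom of sign in the
  following two lemmas.
\<close>

lemma admissibleI_q_1_mod_3:
  assumes "A + B > 0" and "[int q = 1] (mod 3)"
    and "gcd d (int q + 1) = 1" and "int A - int B = d \<or> int A - int B = - d"
  shows "admissible A B"
proof -
  have "gcd (int A - int B) (int q + 1) = 1"
    using assms(3,4) by auto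
  moreover have "q mod 3 = 1"
    using assms(2) by (simp only: residue3_cong_int)
  ultimately show ?thesis
    using assms(1) by (simp add: admissible_def)
qed

lemma admissibleI_q_2_mod_3:
  assumes "A + B > 0" and "[int q = - 1] (mod 3)"
    and "gcd d (int q - 1) = 1" and "int A - int B = d \<or> int A - int B = - d"
    and "A = 0 \<or> B = 0"
  shows "admissible A B"
proof -
  have "gcd (int A - int B) (int q - 1) = 1"
    using assms(3,4) by auto
  moreover have "q mod 3 = 2"
    using assms(2) by (simp only: residue3_cong_int)
  ultimately show ?thesis
    using assms(1,5) by (simp add: admissible_def)
qed

end

section \<open>The permutation criterion\<close>

lemma pm_cong3_iff:
  "pm_cong3 (int Q, int R, int S) (1, 1, 1) \<longleftrightarrow>
     Q mod 3 = 1 \<and> R mod 3 = 1 \<and> S mod 3 = 1 \<or> Q mod 3 = 2 \<and> R mod 3 = 2 \<and> S mod 3 = 2"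
  "pm_cong3 (int Q, int R, int S) (1, 1, - 1) \<longleftrightarrow>
     Q mod 3 = 1 \<and> R mod 3 = 1 \<and> S mod 3 = 2 \<or> Q mod 3 = 2 \<and> R mod 3 = 2 \<and> S mod 3 = 1"
  "pm_cong3 (int Q, int R, int S) (1, - 1, 1) \<longleftrightarrow>
     Q mod 3 = 1 \<and> R mod 3 = 2 \<and> S mod 3 = 1 \<or> Q mod 3 = 2 \<and> R mod 3 = 1 \<and> S mod 3 = 2"
  by (simp_all add: pm_cong3_def residue3_cong_int)

theorem corollary1p5:
  fixes p k q Q R S r :: nat
  assumes "prime p" and "p \<noteq> 3" and "k > 0" and "q = p ^ k"
    and card_field: "card (UNIV :: 'a::{field, finite} set) = q ^ 2"
    and "\<exists>i. Q = p ^ i" and "\<exists>i. R = p ^ i" and "\<exists>i. S = p ^ i"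
    and "r > 0" and "[r = Q + R + S] (mod (q + 1))" and "gcd r (q - 1) = 1"
  shows
    "(([int q = 1] (mod 3) \<and> pm_cong3 (int Q, int R, int S) (1, 1, 1) \<and>
         gcd (int Q + int R + int S) (int q + 1) = 1
       \<or> [int q = -1] (mod 3) \<and> pm_cong3 (int Q, int R, int S) (1, 1, 1) \<and>
         gcd (int Q + int R + int S) (int q - 1) = 1
       \<or> [int q = 1] (mod 3) \<and> pm_cong3 (int Q, int R, int S) (1, 1, -1) \<and>
         gcd (int Q + int R - int S) (int q + 1) = 1)
      \<longrightarrow> (\<forall>B \<in> {B1 Q R S, B2 Q R S :: 'a poly}. permutation_poly (f_poly q r B)))
     \<and>
     (([int q = 1] (mod 3) \<and> pm_cong3 (int Q, int R, int S) (1, 1, -1) \<and>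
         gcd (int Q + int R + int S) (int q + 1) = 1
       \<or> [int q = -1] (mod 3) \<and> pm_cong3 (int Q, int R, int S) (1, 1, -1) \<and>
         gcd (int Q + int R + int S) (int q - 1) = 1
       \<or> [int q = 1] (mod 3) \<and> pm_cong3 (int Q, int R, int S) (1, 1, 1) \<and>
         gcd (int Q + int R - int S) (int q + 1) = 1
       \<or> [int q = 1] (mod 3) \<and> pm_cong3 (int Q, int R, int S) (1, -1, 1) \<and>
         gcd (int Q - int R - int S) (int q + 1) = 1)
      \<longrightarrow> (\<forall>B \<in> {B3 Q R S, B4 Q R S :: 'a poly}. permutation_poly (f_poly q r B)))"
proof -
  obtain i j l where Q: "Q = p ^ i" and R: "R = p ^ j" and S: "S = p ^ l"
    using assms by auto
  have "\<not> 3 dvd p"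
    using assms(1,2) primes_dvd_imp_eq[of 3 p] by auto
  then have "\<not> 3 dvd q"
    using \<open>q = p ^ k\<close> prime_dvd_power[of 3 p k] by auto
  then have "q mod 3 = 1 \<or> q mod 3 = 2"
    by presburger
  then have "q\<^sup>2 mod 3 = 1"
    by (auto simp: power_mod [symmetric, of q])
  then have "3 dvd q\<^sup>2 - 1"
    by presburger
  then obtain \<omega> :: 'a where \<omega>: "\<omega>\<^sup>2 + \<omega> + 1 = 0" "\<omega> \<noteq> 1"
    using exists_primitive_cube_root[where 'a = 'a] card_field by auto
  interpret quadratic_field_with_cube_root p k q \<omega>
    using assms \<omega> by unfold_locales auto
  have r: "r > 0" "gcd r (q - 1) = 1" "[r = Q + R + S] (mod (q + 1))"
    using assms by auto
  have pos: "Q > 0"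
    using p by (simp add: Q prime_gt_0_nat)
  note perm12 = permutation_poly_symmetric[OF _ Q R S r]
  note perm34 = permutation_poly_inverted[OF _ Q R S r]
  show ?thesis
  proof (intro conjI impI, goal_cases)
    case 1
    let ?A = "pos_part3 Q + pos_part3 R + pos_part3 S"
    let ?B = "neg_part3 Q + neg_part3 R + neg_part3 S"
    have "?A + ?B > 0"
      using pos by (auto simp: pos_part3_def neg_part3_def)
    from 1 have adm: "admissible ?A ?B"
    proof (elim disjE conjE, goal_cases)
      case 1
      then show ?case
        by (intro admissibleI_q_1_mod_3[OF \<open>?A + ?B > 0\<close> 1(1,3)])
          (auto simp: pm_cong3_iff pos_part3_def neg_part3_def)
    next
      case 2
      then show ?case
        by (intro admissibleI_q_2_mod_3[OF \<open>?A + ?B > 0\<close> 2(1,3)])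
          (auto simp: pm_cong3_iff pos_part3_def neg_part3_def)
    next
      case 3
      then show ?case
        by (intro admissibleI_q_1_mod_3[OF \<open>?A + ?B > 0\<close> 3(1,3)])
          (auto simp: pm_cong3_iff pos_part3_def neg_part3_def)
    qed
    show ?case
      using perm12[of 1 "B1 Q R S", OF _ _ adm] perm12[of "- 1" "B2 Q R S", OF _ _ adm]
      by (simp add: B1_def B2_def poly_monom power_add)
  next
    case 2
    let ?A = "pos_part3 Q + pos_part3 R + neg_part3 S"
    let ?B = "neg_part3 Q + neg_part3 R + pos_part3 S"
    have "?A + ?B > 0"
      using pos by (auto simp: pos_part3_def neg_part3_def)
    from 2 have adm: "admissible ?A ?B"
    proof (elim disjE conjE, goal_cases)
      case 1
      then show ?case
        by (intro admissibleI_q_1_mod_3[OF \<open>?A + ?B > 0\<close> 1(1,3)])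
          (auto simp: pm_cong3_iff pos_part3_def neg_part3_def)
    next
      case 2
      then show ?case
        by (intro admissibleI_q_2_mod_3[OF \<open>?A + ?B > 0\<close> 2(1,3)])
          (auto simp: pm_cong3_iff pos_part3_def neg_part3_def)
    next
      case 3
      then show ?case
        by (intro admissibleI_q_1_mod_3[OF \<open>?A + ?B > 0\<close> 3(1,3)])
          (auto simp: pm_cong3_iff pos_part3_def neg_part3_def)
    next
      case 4
      then show ?case
        by (intro admissibleI_q_1_mod_3[OF \<open>?A + ?B > 0\<close> 4(1,3)])
          (auto simp: pm_cong3_iff pos_part3_def neg_part3_def)
    qed
    show ?case
      using perm34[of 1 "B3 Q R S", OF _ _ adm] perm34[of "- 1" "B4 Q R S", OF _ _ adm]
      by (simp add: B3_def B4_def poly_monom power_add)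
  qed
qed

end
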